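(* Let $p$ be a prime and let $n\ge 0$ be an integer. Then $p^2$ divides $F(p^2,n)$, unless $n$ is of one of the following two forms: (i) $n=\frac{p^{2t}-1}{p^2-1}$ with $t\in\mathbb{N}$, in which case $F(p^2,n)\equiv 1\pmod{p^2}$; or (ii) $n=\frac{c_1p^{2i_1+1}+\cdots+c_sp^{2i_s+1}-1}{p^2-1}$, where $s\ge 1$ is an integer, $i_1<\cdots<i_s$ are nonnegative integers, and $c_1,\dots,c_s$ are integers with $0\le c_k<p$ for all $k$ and $\sum_{k=1}^s c_k=p$, in which case $$F(p^2,n)\equiv\binom{p}{c_1,c_2,\ldots,c_s}\pmod{p^2}.$$
   Context: For integers $s\ge 1$ and $n\ge 0$, the $s$-Catalan number is the integer $F(s,n)=\frac{1}{(s-1)n+1}\binom{sn}{n}$. The symbol $\binom{p}{c_1,\ldots,c_s}=\frac{p!}{c_1!\cdots c_s!}$ is the multinomial coefficient. Here $\mathbb{N}=\{0,1,2,\dots\}$. *)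

theory Defs
  imports Complex_Main "HOL-Computational_Algebra.Primes" "HOL-Number_Theory.Cong"
begin

text \<open>The truncating division is exact for \<open>s \<ge> 1\<close>, see \<open>s_catalan_exact\<close> below.\<close>

definition s_catalan :: "nat \<Rightarrow> nat \<Rightarrow> nat" where
  "s_catalan s n = (s * n choose n) div ((s - 1) * n + 1)"

lemma s_catalan_dvd:
  fixes s n :: nat
  assumes "s \<ge> 1"
  shows "(s - 1) * n + 1 dvd (s * n choose n)"
proof (cases n)
  case 0
  then show ?thesis by simp
next
  case (Suc k)
  define m where "m = (s - 1) * n"
  have sn: "s * n = m + n"
    using assms by (cases s) (simp_all add: m_def)
  have "n * (m + n choose n) = (m + 1) * (m + n choose k)"
  proof -
    have "Suc k * (m + Suc k choose Suc k) = (m + Suc k - k) * (m + Suc k choose k)"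
      by (metis binomial_absorb_comp binomial_absorption diff_Suc_1 add_Suc_right)
    then show ?thesis by (simp add: Suc)
  qed
  then have "m + 1 dvd n * (m + n choose n)" by (metis dvd_triv_left)
  moreover have "coprime (m + 1) n"
    unfolding m_def by (metis coprime_Suc_left_nat coprime_mult_right_iff Suc_eq_plus1)
  ultimately show ?thesis
    using sn by (simp add: coprime_dvd_mult_right_iff m_def)
qed

lemma s_catalan_exact:
  fixes s n :: nat
  assumes "s \<ge> 1"
  shows "real (s_catalan s n) = 1 / (real (s - 1) * real n + 1) * real (s * n choose n)"
proof -
  have "real (s_catalan s n) = real (s * n choose n) / real ((s - 1) * n + 1)"
    unfolding s_catalan_def by (rule real_of_nat_div[OF s_catalan_dvd[OF assms]])
  then show ?thesis by simp
qed

text \<open>\<open>multinomial N s c\<close> is the coefficient with lower entries \<open>c 1, \<dots>, c s\<close>; the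
  division is exact when these sum to \<open>N\<close>, see \<open>multinomial_exact\<close>.\<close>

definition multinomial :: "nat \<Rightarrow> nat \<Rightarrow> (nat \<Rightarrow> nat) \<Rightarrow> nat" where
  "multinomial N s c = fact N div (\<Prod>k=1..s. fact (c k))"

lemma prod_fact_dvd_fact_sum:
  fixes c :: "nat \<Rightarrow> nat"
  shows "(\<Prod>k=1..s. fact (c k) :: nat) dvd fact (\<Sum>k=1..s. c k)"
proof (induction s)
  case 0
  show ?case by simp
next
  case (Suc s)
  have "(fact (\<Sum>k=1..s. c k) * fact (c (Suc s)) :: nat) dvd fact ((\<Sum>k=1..s. c k) + c (Suc s))"
    by (rule fact_fact_dvd_fact)
  from dvd_trans[OF mult_dvd_mono[OF Suc dvd_refl] this] show ?case
    by simp
qed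

lemma multinomial_exact:
  assumes "(\<Sum>k=1..s. c k) = N"
  shows "real (multinomial N s c) = fact N / (\<Prod>k=1..s. fact (c k))"
  using real_of_nat_div[OF prod_fact_dvd_fact_sum[of c s]] assms
  by (simp add: multinomial_def)

definition is_form_i :: "nat \<Rightarrow> nat \<Rightarrow> bool" where
  "is_form_i p n \<longleftrightarrow> (\<exists>t::nat. real n = (real p ^ (2 * t) - 1) / (real p ^ 2 - 1))"

definition is_form_ii :: "nat \<Rightarrow> nat \<Rightarrow> nat \<Rightarrow> (nat \<Rightarrow> nat) \<Rightarrow> (nat \<Rightarrow> nat) \<Rightarrow> bool" where
  "is_form_ii p n s i c \<longleftrightarrow>
     s \<ge> 1 \<and> strict_mono_on {1..s} i \<and> (\<forall>k\<in>{1..s}. c k < p) \<and> (\<Sum>k=1..s. c k) = p \<and>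
     real n = ((\<Sum>k=1..s. real (c k) * real p ^ (2 * i k + 1)) - 1) / (real p ^ 2 - 1)"

end

theory Submission
  imports Defs "HOL-Number_Theory.Residues"
begin

text \<open>
  Put \<open>q = p\<^sup>2\<close>, \<open>m = (q - 1) n + 1\<close> and \<open>F = F(q, n)\<close>. Then \<open>F \<cdot> n! \<cdot> m! = (q n)!\<close>, so the
  valuation of \<open>F\<close> at \<open>p\<close> is governed by base-\<open>p\<close> digit sums. Those of \<open>n\<close> and \<open>q n\<close> agree and
  cancel, and Legendre's formula leaves \<open>(p - 1) v = S - 1\<close>, where \<open>v\<close> is the valuation of
  \<open>F\<close> and \<open>S\<close> is the digit sum of \<open>m\<close>. Hence \<open>p\<^sup>2\<close> fails to divide \<open>F\<close> exactly when
  \<open>S = 1\<close> or \<open>S = p\<close>.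

  The two forms in the theorem describe these two cases. By construction \<open>m \<equiv> 1\<close> modulo
  \<open>q - 1\<close>, while a power of \<open>p\<close> is congruent to \<open>1\<close> or to \<open>p\<close> modulo \<open>q - 1\<close>, according to
  the parity of its exponent. If \<open>a\<close> and \<open>b\<close> are the sums of the digits of \<open>m\<close> in even and in
  odd positions, then \<open>a + b p \<equiv> 1\<close>. For \<open>a + b = 1\<close> this forces \<open>b = 0\<close>, so that \<open>m\<close> is a
  power of \<open>q\<close> (\<open>digit_sum_one\<close>); for \<open>a + b = p\<close> it forces \<open>a = 0\<close>, so that only odd
  positions occur (\<open>digit_sum_prime\<close>).

  If \<open>S = p\<close>, it is enough to know \<open>F / p\<close> modulo \<open>p\<close>, and this follows from the refinement of
  Legendre's formula that also records the unit part of a factorial: \<open>N!\<close> is \<open>(-p)^e\<close>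
  times a number congruent modulo \<open>p\<close> to the product of the factorials of the digits of \<open>N\<close>
  (\<open>fact_digits\<close>). It gives \<open>(F / p) \<cdot> \<Prod> c\<^sub>k! \<equiv> -1 \<equiv> (p - 1)!\<close>, the same congruence that
  \<open>1 / p\<close> times the multinomial coefficient satisfies exactly.

  If \<open>S = 1\<close>, then \<open>F\<close> is a unit at \<open>p\<close> and the refined formula determines it only modulo \<open>p\<close>.
  Instead, the congruence \<open>(p a choose p b) \<equiv> (a choose b)\<close> modulo \<open>p\<^sup>2\<close> yields
  \<open>F(q, q n + 1) \<equiv> F(q, n)\<close> modulo \<open>q\<close> (\<open>s_catalan_prime_square_step\<close>). As \<open>n \<mapsto> q n + 1\<close>
  multiplies \<open>m\<close> by \<open>q\<close>, this step descends from \<open>m = q\<^sup>t\<close> to \<open>F(q, 0) = 1\<close>.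
\<close>

section \<open>Factorials modulo a prime\<close>

text \<open>The factors \<open>N + 1, \<dots>, N + r\<close> are congruent to \<open>1, \<dots>, r\<close>.\<close>

lemma fact_add_cong:
  fixes N p r :: nat
  assumes "p dvd N"
  shows "\<exists>w::int. fact (N + r) = fact N * w \<and> [w = fact r] (mod int p)"
proof (induction r)
  case 0
  show ?case by (intro exI[of _ 1]) simp
next
  case (Suc r)
  then obtain w :: int where w: "fact (N + r) = fact N * w" "[w = fact r] (mod int p)"
    by blast
  have "[int N + int (Suc r) = 0 + int (Suc r)] (mod int p)"
    using assms by (intro cong_add) (auto simp: cong_0_iff)
  from cong_mult[OF this w(2)] have "[(int N + int (Suc r)) * w = fact (Suc r)] (mod int p)"
    by simp
  moreover have "fact (N + Suc r) = (fact N * ((int N + int (Suc r)) * w) :: int)"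
    using w(1) by (simp add: algebra_simps)
  ultimately show ?case by blast
qed

text \<open>Among the factors of \<open>(p a + r)!\<close>, the multiples of \<open>p\<close> contribute \<open>p^a a!\<close>. The others
  form \<open>a\<close> full blocks of nonzero residues, each with product \<open>-1\<close> by Wilson's theorem, and a
  last incomplete block with product \<open>r!\<close>. Writing \<open>(-p)^a\<close> in place of \<open>p^a\<close> absorbs the signs.\<close>

lemma fact_mult_prime_add:
  fixes p a r :: nat
  assumes p: "prime p"
  shows "\<exists>w::int. fact (p * a + r) = w * (- int p) ^ a * fact a \<and> [w = fact r] (mod int p)"
proof -
  have "\<exists>w::int. fact (p * a) = w * (- int p) ^ a * fact a \<and> [w = 1] (mod int p)"
  proof (induction a)
    case 0
    show ?case by (intro exI[of _ 1]) simp
  next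
    case (Suc a)
    then obtain w :: int where w: "fact (p * a) = w * (- int p) ^ a * fact a" "[w = 1] (mod int p)"
      by blast
    obtain x :: int where x: "fact (p * a + (p - 1)) = fact (p * a) * x" "[x = fact (p - 1)] (mod int p)"
      using fact_add_cong[of p "p * a" "p - 1"] by auto
    have x1: "[x = - 1] (mod int p)"
      using cong_trans[OF x(2) wilson_theorem[OF p]] .
    have "p * Suc a = Suc (p * a + (p - 1))"
      using prime_gt_0_nat[OF p] by simp
    then have "fact (p * Suc a) = (int (p * Suc a) * fact (p * a + (p - 1)) :: int)"
      by (metis fact_Suc of_nat_id)
    also have "\<dots> = (w * (- x)) * (- int p) ^ Suc a * fact (Suc a)"
      unfolding x(1) w(1) by (simp add: algebra_simps)
    finally have "fact (p * Suc a) = (w * (- x)) * (- int p) ^ Suc a * fact (Suc a)" .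
    moreover have "[w * (- x) = 1 * (- (- 1))] (mod int p)"
      using x1 by (intro cong_mult w(2)) (simp only: cong_minus_minus_iff)
    ultimately show ?case by (intro exI[of _ "w * (- x)"]) simp
  qed
  then obtain w :: int where w: "fact (p * a) = w * (- int p) ^ a * fact a" "[w = 1] (mod int p)"
    by blast
  obtain x :: int where x: "fact (p * a + r) = fact (p * a) * x" "[x = fact r] (mod int p)"
    using fact_add_cong[of p "p * a" r] by auto
  have "fact (p * a + r) = (w * x) * (- int p) ^ a * fact a"
    unfolding x(1) w(1) by (simp add: algebra_simps)
  moreover have "[w * x = fact r] (mod int p)"
    using cong_mult[OF w(2) x(2)] by simp
  ultimately show ?thesis by blast
qed

text \<open>Legendre's formula together with its refinement (due to Stickelberger) for the unit part.
  The digits are a function on an initial segment of positions, rather than computed from the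
  number, so that leading zeros are harmless and expansions can be supplied from outside; the
  induction splits off the lowest digit.\<close>

lemma fact_digits:
  fixes p N :: nat and d :: "nat \<Rightarrow> nat"
  assumes p: "prime p"
  shows "\<exists>(u::int) e. fact (\<Sum>i<N. d i * p ^ i) = u * (- int p) ^ e
           \<and> [u = (\<Prod>i<N. fact (d i))] (mod int p)
           \<and> (p - 1) * e + (\<Sum>i<N. d i) = (\<Sum>i<N. d i * p ^ i)"
proof (induction N arbitrary: d)
  case 0
  show ?case by (intro exI[of _ 1] exI[of _ 0]) simp
next
  case (Suc N)
  define M where "M = (\<Sum>i<N. d (Suc i) * p ^ i)"
  have M: "(\<Sum>i<Suc N. d i * p ^ i) = p * M + d 0"
    unfolding M_def sum.lessThan_Suc_shift by (simp add: sum_distrib_left mult_ac)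
  obtain u :: int and e where u: "fact M = u * (- int p) ^ e"
      "[u = (\<Prod>i<N. fact (d (Suc i)))] (mod int p)"
      "(p - 1) * e + (\<Sum>i<N. d (Suc i)) = M"
    unfolding M_def using Suc[of "\<lambda>i. d (Suc i)"] by blast
  obtain w :: int where w: "fact (p * M + d 0) = w * (- int p) ^ M * fact M"
      "[w = fact (d 0)] (mod int p)"
    using fact_mult_prime_add[OF p] by blast
  have "fact (p * M + d 0) = (w * u) * (- int p) ^ (M + e)"
    unfolding w(1) u(1) by (simp add: power_add)
  moreover have "[w * u = (\<Prod>i<Suc N. fact (d i))] (mod int p)"
    unfolding prod.lessThan_Suc_shift using cong_mult[OF w(2) u(2)] by simp
  moreover have "(p - 1) * (M + e) + (\<Sum>i<Suc N. d i) = p * M + d 0"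
  proof -
    have "(p - 1) * (M + e) + (\<Sum>i<Suc N. d i) = (p - 1) * M + ((p - 1) * e + (\<Sum>i<N. d (Suc i))) + d 0"
      unfolding sum.lessThan_Suc_shift by (simp only: add_mult_distrib2 ac_simps)
    also have "\<dots> = ((p - 1) + 1) * M + d 0"
      unfolding u(3) by (simp only: add_mult_distrib mult_1_left)
    finally show ?thesis using prime_gt_0_nat[OF p] by simp
  qed
  ultimately show ?case unfolding M by blast
qed

section \<open>The s-Catalan number as a quotient of factorials\<close>

lemma s_catalan_mult:
  assumes "s \<ge> 1"
  shows "s_catalan s n * ((s - 1) * n + 1) = (s * n choose n)"
  unfolding s_catalan_def using s_catalan_dvd[OF assms] by (rule dvd_div_mult_self)

lemma s_catalan_fact:
  assumes "s \<ge> 1"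
  shows "s_catalan s n * fact ((s - 1) * n + 1) * fact n = fact (s * n)"
proof -
  have "n \<le> s * n" and diff: "s * n - n = (s - 1) * n"
    using assms by (simp_all add: diff_mult_distrib)
  then have "fact n * fact ((s - 1) * n) * (s * n choose n) = fact (s * n)"
    using binomial_fact_lemma[of n "s * n"] by simp
  then show ?thesis
    unfolding s_catalan_mult[OF assms, symmetric] by (simp add: algebra_simps)
qed

text \<open>Only \<open>m!\<close> needs to be expanded in digits: applying
  \<open>fact_mult_prime_add\<close> twice relates \<open>(p\<^sup>2 n)!\<close> to \<open>n!\<close>, which cancels. The exponents in
  \<open>(p\<^sup>2 n)!/n!\<close> and in \<open>m!\<close> are \<open>(p + 1) n\<close> and \<open>e\<close>, with \<open>(p - 1) e\<close> equal to \<open>m\<close> minus the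
  digit sum, and their difference is \<open>v\<close>. For digits below \<open>p\<close> the number \<open>u\<close> is prime to
  \<open>p\<close>, so \<open>v\<close> is the valuation of the Catalan number.\<close>

lemma s_catalan_prime_square_digits:
  fixes p n N :: nat and d :: "nat \<Rightarrow> nat"
  assumes p: "prime p" and m: "(p\<^sup>2 - 1) * n + 1 = (\<Sum>i<N. d i * p ^ i)"
    and pos: "(\<Sum>i<N. d i) \<noteq> 0"
  shows "\<exists>(u::int) (u0::int) v. int (s_catalan (p\<^sup>2) n) * u = u0 * (- int p) ^ v
           \<and> [u = (\<Prod>i<N. fact (d i))] (mod int p) \<and> [u0 = 1] (mod int p)
           \<and> (p - 1) * v + 1 = (\<Sum>i<N. d i)"
proof -
  define m where "m = (p\<^sup>2 - 1) * n + 1"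
  define S where "S = (\<Sum>i<N. d i)"
  have p2: "2 \<le> p" using p by (rule prime_ge_2_nat)
  obtain u :: int and e where u: "fact m = u * (- int p) ^ e"
      "[u = (\<Prod>i<N. fact (d i))] (mod int p)" "(p - 1) * e + S = m"
    using fact_digits[OF p, where N = N and d = d] unfolding m_def S_def m by blast
  obtain x :: int where x: "fact (p * n) = x * (- int p) ^ n * fact n" "[x = 1] (mod int p)"
    using fact_mult_prime_add[OF p, of n 0] by auto
  obtain y :: int where y: "fact (p * (p * n)) = y * (- int p) ^ (p * n) * fact (p * n)"
      "[y = 1] (mod int p)"
    using fact_mult_prime_add[OF p, of "p * n" 0] by auto
  have "int (s_catalan (p\<^sup>2) n) * fact m * fact n = fact (p\<^sup>2 * n)"
    using arg_cong[OF s_catalan_fact[of "p\<^sup>2" n, folded m_def], of int] p2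
    by (simp only: of_nat_mult of_nat_fact) simp
  also have "\<dots> = (x * y) * (- int p) ^ ((p + 1) * n) * fact n"
    using x(1) y(1) by (simp add: power2_eq_square mult.assoc power_add algebra_simps)
  finally have F: "int (s_catalan (p\<^sup>2) n) * fact m = (x * y) * (- int p) ^ ((p + 1) * n)"
    by simp
  have psq: "p\<^sup>2 - 1 = (p - 1) * (p + 1)"
    by (simp add: power2_eq_square algebra_simps)
  have E: "(p - 1) * e + S = (p - 1) * ((p + 1) * n) + 1"
    unfolding u(3) m_def psq by (simp only: mult.assoc)
  \<comment> \<open>The digit sum is positive, so subtracting the exponents does not truncate.\<close>
  have le: "e \<le> (p + 1) * n"
  proof (rule ccontr)
    assume "\<not> e \<le> (p + 1) * n"
    then have "(p - 1) * ((p + 1) * n) + (p - 1) \<le> (p - 1) * e"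
      by (metis mult_le_mono2 mult_Suc_right add.commute not_less_eq_eq)
    moreover have "S \<ge> 1" "p - 1 \<ge> 1" using pos p2 unfolding S_def by linarith+
    ultimately show False using E by linarith
  qed
  define v where "v = (p + 1) * n - e"
  have v: "(p + 1) * n = e + v" using le by (simp add: v_def)
  have "(int (s_catalan (p\<^sup>2) n) * u) * (- int p) ^ e = ((x * y) * (- int p) ^ v) * (- int p) ^ e"
    using F unfolding u(1) v power_add by (simp add: mult_ac)
  then have "int (s_catalan (p\<^sup>2) n) * u = (x * y) * (- int p) ^ v"
    using p2 by simp
  moreover have "[x * y = 1] (mod int p)"
    using cong_mult[OF x(2) y(2)] by simp
  moreover have "(p - 1) * v + 1 = S"
    using E unfolding v add_mult_distrib2 by linarith
  ultimately show ?thesis using u(2) unfolding S_def by blast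
qed

lemma coprime_prod_fact_digits:
  fixes p N :: nat and d :: "nat \<Rightarrow> nat"
  assumes p: "prime p" and d: "\<And>i. i < N \<Longrightarrow> d i < p"
  shows "coprime (\<Prod>i<N. fact (d i) :: int) (int p)"
proof (rule prod_coprime_left)
  fix i assume "i \<in> {..<N}"
  then have "\<not> p dvd fact (d i)"
    using p d[of i] by (simp add: prime_dvd_fact_iff)
  then have "coprime (fact (d i)) p"
    using p by (metis coprime_commute prime_imp_coprime)
  then show "coprime (fact (d i) :: int) (int p)"
    by (metis coprime_int_iff of_nat_fact)
qed

section \<open>Congruences modulo the square of the prime\<close>

lemma prime_square_gt_1: "prime (p::nat) \<Longrightarrow> p\<^sup>2 > 1"
  using prime_gt_1_nat by (intro one_less_power) auto

lemma prime_dvd_choose_mult: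
  fixes p a j :: nat
  assumes p: "prime p" and j: "\<not> p dvd j"
  shows "p dvd (p * a choose j)"
proof -
  obtain k where k: "j = Suc k" using j by (cases j) auto
  show ?thesis
  proof (cases "p * a")
    case 0
    then show ?thesis unfolding k by (simp only: binomial_0_Suc dvd_0_right)
  next
    case (Suc b)
    have "j * (p * a choose j) = p * a * (b choose k)"
      using Suc_times_binomial[of k b] unfolding k Suc .
    then have "p dvd j * (p * a choose j)" by (simp add: mult.assoc)
    then show ?thesis using p j by (simp add: prime_dvd_mult_iff)
  qed
qed

text \<open>In the Vandermonde expansion of \<open>(p + p a choose p b)\<close> only the terms that take none or
  all of the first \<open>p\<close> elements survive: for \<open>0 < k < p\<close> both \<open>(p choose k)\<close> and
  \<open>(p a choose (p b - k))\<close> are divisible by \<open>p\<close>. The two survivors reproduce Pascal's rule.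
  The argument is uniform in \<open>p\<close>, including \<open>p = 2\<close>.\<close>

lemma babbage:
  fixes p a b :: nat
  assumes p: "prime p"
  shows "[(p * a choose (p * b)) = (a choose b)] (mod p\<^sup>2)"
proof (induction a arbitrary: b)
  case 0
  show ?case using prime_gt_0_nat[OF p] by (cases "b = 0") (auto simp: binomial_eq_0)
next
  case (Suc a)
  show ?case
  proof (cases b)
    case 0
    then show ?thesis by simp
  next
    case (Suc c)
    let ?f = "\<lambda>k. (p choose k) * (p * a choose (p * b - k))"
    have p0: "0 < p" using p by (rule prime_gt_0_nat)
    have sub: "{0, p} \<subseteq> {..p * b}" using Suc by auto
    have "(p * Suc a choose (p * b)) = (\<Sum>k\<le>p * b. ?f k)"
      using vandermonde[of p "p * a" "p * b"] by simp
    also have "\<dots> = (\<Sum>k\<in>{0, p}. ?f k) + (\<Sum>k\<in>{..p * b} - {0, p}. ?f k)"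
      using sum.subset_diff[OF sub, of ?f] by (simp add: add.commute)
    finally have eq: "(p * Suc a choose (p * b)) =
        (\<Sum>k\<in>{0, p}. ?f k) + (\<Sum>k\<in>{..p * b} - {0, p}. ?f k)" .
    have "(\<Sum>k\<in>{0, p}. ?f k) = (p * a choose (p * b)) + (p * a choose (p * c))"
      using p0 Suc by simp
    moreover have "[(\<Sum>k\<in>{..p * b} - {0, p}. ?f k) = 0] (mod p\<^sup>2)"
      unfolding cong_0_iff
    proof (rule dvd_sum)
      fix k assume k: "k \<in> {..p * b} - {0, p}"
      show "p\<^sup>2 dvd ?f k"
      proof (cases "k < p")
        case True
        have 1: "p dvd (p choose k)"
          using k True p by (intro dvd_choose_prime) auto
        have "\<not> p dvd k" using k True by (auto dest: dvd_imp_le)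
        moreover have "p dvd k" if "p dvd p * b - k"
          using dvd_diff_nat[OF dvd_triv_left[of p b] that] k by simp
        ultimately have "p dvd (p * a choose (p * b - k))"
          by (intro prime_dvd_choose_mult[OF p]) auto
        with 1 show ?thesis unfolding power2_eq_square by (rule mult_dvd_mono)
      next
        case False
        then show ?thesis using k by (simp add: binomial_eq_0)
      qed
    qed
    ultimately have "[(p * Suc a choose (p * b)) =
        ((p * a choose (p * b)) + (p * a choose (p * c))) + 0] (mod p\<^sup>2)"
      unfolding eq by (intro cong_add) simp_all
    also have "[((p * a choose (p * b)) + (p * a choose (p * c))) + 0 =
        ((a choose b) + (a choose c)) + 0] (mod p\<^sup>2)"
      by (intro cong_add Suc.IH cong_refl)
    also have "((a choose b) + (a choose c)) + 0 = (Suc a choose b)"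
      using Suc by simp
    finally show ?thesis .
  qed
qed

text \<open>Shifting the lower index of \<open>(s n choose (s - 1) n)\<close> by one replaces the denominator
  \<open>(s - 1) n + 1\<close> by the factor \<open>n\<close>. With \<open>s = p\<^sup>2\<close> and \<open>n \<equiv> 1\<close> modulo \<open>p\<^sup>2\<close>, this turns the
  Catalan number into a binomial coefficient modulo \<open>p\<^sup>2\<close> without any division.\<close>

lemma s_catalan_times_index:
  assumes "s \<ge> 1"
  shows "(s * n choose ((s - 1) * n + 1)) = n * s_catalan s n"
proof -
  define k where "k = (s - 1) * n"
  have sn: "s * n = k + n" using assms by (cases s) (simp_all add: k_def)
  have "Suc k * (k + n choose Suc k) = n * (k + n choose k)"
    using binomial_absorb_comp[of "k + n" k] binomial_absorption[of k "k + n"] by simp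
  also have "(k + n choose k) = (k + n choose n)"
    using binomial_symmetric[of k "k + n"] by simp
  also have "\<dots> = s_catalan s n * Suc k"
    using s_catalan_mult[OF assms, of n] unfolding sn k_def by simp
  finally have "Suc k * (k + n choose Suc k) = Suc k * (n * s_catalan s n)"
    by (simp add: mult_ac)
  then have "(k + n choose Suc k) = n * s_catalan s n"
    by (simp only: nat_mult_eq_cancel1 zero_less_Suc)
  then show ?thesis unfolding sn k_def by simp
qed

text \<open>With \<open>n' = q n + 1\<close> one has \<open>(q - 1) n' + 1 = q (k + 1)\<close> for \<open>k = (q - 1) n\<close>. Both indices
  in \<open>F(q, n') \<equiv> n' F(q, n') = (q n' choose q (k + 1))\<close> are divisible by \<open>q\<close>, and two
  applications of \<open>babbage\<close> leave \<open>(n' choose (k + 1))\<close>. By Pascal's rule this is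
  \<open>n' F(q, n) \<equiv> F(q, n)\<close>.\<close>

lemma s_catalan_prime_square_step:
  fixes p n :: nat
  assumes p: "prime p"
  shows "[s_catalan (p\<^sup>2) (p\<^sup>2 * n + 1) = s_catalan (p\<^sup>2) n] (mod p\<^sup>2)"
proof -
  define q where "q = p\<^sup>2"
  define k where "k = (q - 1) * n"
  define n' where "n' = q * n + 1"
  have q1: "q \<ge> 1" using prime_gt_0_nat[OF p] by (simp add: q_def)
  have n'1: "[n' = 1] (mod q)"
    unfolding n'_def by (simp only: cong_def mod_mult_self4)
  have qn: "q * n = k + n" using q1 by (cases q) (simp_all add: k_def)
  have m': "(q - 1) * n' + 1 = q * (k + 1)"
    using q1 by (cases q) (simp_all add: k_def n'_def algebra_simps)
  have "[n' * s_catalan q n' = 1 * s_catalan q n'] (mod q)"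
    using n'1 by (intro cong_mult cong_refl)
  then have "[s_catalan q n' = n' * s_catalan q n'] (mod q)"
    by (simp add: cong_sym)
  also have "n' * s_catalan q n' = (q * n' choose (q * (k + 1)))"
    using s_catalan_times_index[OF q1, of n'] unfolding m' by simp
  also have "[(q * n' choose (q * (k + 1))) = (p * n' choose (p * (k + 1)))] (mod q)"
    using babbage[OF p, of "p * n'" "p * (k + 1)"]
    unfolding q_def power2_eq_square mult.assoc .
  also have "[(p * n' choose (p * (k + 1))) = (n' choose (k + 1))] (mod q)"
    using babbage[OF p, of "n'" "k + 1"] unfolding q_def .
  also have "(n' choose (k + 1)) = (q * n choose k) + (q * n choose (k + 1))"
    by (simp add: n'_def)
  also have "(q * n choose k) = (q * n choose n)"
    using binomial_symmetric[of k "k + n"] unfolding qn by simp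
  also have "\<dots> = s_catalan q n * (k + 1)"
    using s_catalan_mult[OF q1, of n] by (simp add: k_def)
  also have "(q * n choose (k + 1)) = n * s_catalan q n"
    using s_catalan_times_index[OF q1, of n] by (simp add: k_def)
  also have "s_catalan q n * (k + 1) + n * s_catalan q n = n' * s_catalan q n"
    unfolding n'_def qn by (simp add: algebra_simps)
  also have "[n' * s_catalan q n = 1 * s_catalan q n] (mod q)"
    using n'1 by (intro cong_mult cong_refl)
  finally show ?thesis by (simp add: q_def n'_def)
qed

lemma s_catalan_repunit:
  fixes p n t :: nat
  assumes p: "prime p" and n: "(p\<^sup>2 - 1) * n + 1 = (p\<^sup>2) ^ t"
  shows "[s_catalan (p\<^sup>2) n = 1] (mod p\<^sup>2)"
  using n
proof (induction t arbitrary: n)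
  case 0
  have "p\<^sup>2 - 1 > 0" using prime_square_gt_1[OF p] by simp
  with 0 have "n = 0" by simp
  then show ?case by (simp add: s_catalan_def)
next
  case (Suc t)
  define q where "q = p\<^sup>2"
  have q1: "q > 1" unfolding q_def using p by (rule prime_square_gt_1)
  have "[q ^ t = 1] (mod (q - 1))"
    using cong_pow[of q 1 "q - 1" t] q1 by (simp add: cong_def mod_if)
  then have "q - 1 dvd q ^ t - 1"
    using q1 by (metis cong_altdef_nat cong_sym one_le_power less_imp_le)
  then obtain k where "q ^ t - 1 = (q - 1) * k" by (elim dvdE)
  then have k: "(q - 1) * k + 1 = q ^ t"
    using q1 by (metis add.commute le_add_diff_inverse one_le_power less_imp_le)
  have "(q - 1) * n + 1 = q * ((q - 1) * k + 1)"
    using Suc.prems unfolding k unfolding q_def by simp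
  also have "\<dots> = (q - 1) * (q * k + 1) + 1"
    using q1 by (cases q) (simp_all add: algebra_simps)
  finally have "(q - 1) * n = (q - 1) * (q * k + 1)" by linarith
  then have "n = q * k + 1" using q1 unfolding mult_cancel1 by linarith
  then have "[s_catalan q n = s_catalan q k] (mod q)"
    using s_catalan_prime_square_step[OF p, of k] by (simp add: q_def)
  also have "[s_catalan q k = 1] (mod q)"
    using Suc.IH[of k] k unfolding q_def by simp
  finally show ?case by (simp add: q_def)
qed

section \<open>Base-p expansions of integers congruent to 1 modulo p^2 - 1\<close>

lemma sum_lessThan_double:
  fixes f :: "nat \<Rightarrow> 'a::comm_monoid_add"
  shows "(\<Sum>i<2 * N. f i) = (\<Sum>i<N. f (2 * i)) + (\<Sum>i<N. f (2 * i + 1))"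
  by (induction N) (simp_all add: ac_simps)

lemma base_expansion:
  fixes p m :: nat
  shows "(\<Sum>i<N. (m div p ^ i mod p) * p ^ i) = m mod p ^ N"
proof (induction N)
  case (Suc N)
  then show ?case using mod_mult2_eq[of m "p ^ N" p] by (simp add: mult_ac)
qed simp

text \<open>The base-\<open>p\<close> analogue of casting out: \<open>p\<^sup>2 \<equiv> 1\<close>, so even positions have weight \<open>1\<close> and odd
  positions weight \<open>p\<close>.\<close>

lemma digits_alternating:
  fixes p n N :: nat and d :: "nat \<Rightarrow> nat"
  assumes p: "prime p" and m: "(p\<^sup>2 - 1) * n + 1 = (\<Sum>i<2 * N. d i * p ^ i)"
  shows "[(\<Sum>i<N. d (2 * i)) + p * (\<Sum>i<N. d (2 * i + 1)) = 1] (mod (p\<^sup>2 - 1))"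
proof -
  have q: "p\<^sup>2 > 1" using p by (rule prime_square_gt_1)
  have "[p\<^sup>2 = 1] (mod (p\<^sup>2 - 1))"
    using q by (simp add: cong_def mod_if)
  then have pw: "[p ^ (2 * i) = 1] (mod (p\<^sup>2 - 1))" for i
    using cong_pow[of "p\<^sup>2" 1 "p\<^sup>2 - 1" i] by (simp add: power_mult)
  have "[(\<Sum>i<N. d (2 * i) * p ^ (2 * i)) + p * (\<Sum>i<N. d (2 * i + 1) * p ^ (2 * i))
      = (\<Sum>i<N. d (2 * i) * 1) + p * (\<Sum>i<N. d (2 * i + 1) * 1)] (mod (p\<^sup>2 - 1))"
    by (intro cong_add cong_mult cong_sum cong_refl pw)
  also have "(\<Sum>i<N. d (2 * i) * p ^ (2 * i)) + p * (\<Sum>i<N. d (2 * i + 1) * p ^ (2 * i))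
      = (p\<^sup>2 - 1) * n + 1"
    unfolding m sum_lessThan_double by (simp add: sum_distrib_left mult_ac)
  finally have "[(\<Sum>i<N. d (2 * i)) + p * (\<Sum>i<N. d (2 * i + 1)) = (p\<^sup>2 - 1) * n + 1] (mod (p\<^sup>2 - 1))"
    by (simp add: cong_sym_eq)
  also have "[(p\<^sup>2 - 1) * n + 1 = 1] (mod (p\<^sup>2 - 1))"
    unfolding cong_def by (simp only: mod_mult_self4)
  finally show ?thesis .
qed

text \<open>The single nonzero digit cannot be in an odd position, since \<open>0 < p - 1 < p\<^sup>2 - 1\<close> shows that
  \<open>p\<close> is not congruent to \<open>1\<close>.\<close>

lemma digit_sum_one:
  fixes p n N :: nat and d :: "nat \<Rightarrow> nat"
  assumes p: "prime p" and m: "(p\<^sup>2 - 1) * n + 1 = (\<Sum>i<2 * N. d i * p ^ i)"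
    and S: "(\<Sum>i<2 * N. d i) = 1"
  shows "\<exists>t. (p\<^sup>2 - 1) * n + 1 = (p\<^sup>2) ^ t"
proof -
  define a where "a = (\<Sum>i<N. d (2 * i))"
  define b where "b = (\<Sum>i<N. d (2 * i + 1))"
  have p1: "p > 1" using p by (rule prime_gt_1_nat)
  have ab: "a + b = 1" using S unfolding sum_lessThan_double a_def b_def .
  have c: "[a + p * b = 1] (mod (p\<^sup>2 - 1))"
    using digits_alternating[OF p m] unfolding a_def b_def .
  have b0: "b = 0"
  proof (rule ccontr)
    assume "b \<noteq> 0"
    with ab have "a = 0" "b = 1" by auto
    with c have "[p = 1] (mod (p\<^sup>2 - 1))" by simp
    then have "p\<^sup>2 - 1 dvd p - 1" using p1 by (simp add: cong_altdef_nat)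
    then have "p\<^sup>2 - 1 \<le> p - 1" using p1 by (intro dvd_imp_le) auto
    moreover have "p * 2 \<le> p\<^sup>2" using p1 by (simp add: power2_eq_square)
    ultimately show False using p1 by linarith
  qed
  with ab have "(\<Sum>i<N. d (2 * i)) = 1" by (simp add: a_def)
  then obtain t where t: "t < N" "d (2 * t) = 1" "\<And>i. i < N \<Longrightarrow> i \<noteq> t \<Longrightarrow> d (2 * i) = 0"
    by (auto simp: sum_eq_Suc0_iff)
  have odd: "d (2 * i + 1) = 0" if "i < N" for i
    using b0 that by (simp add: b_def)
  have "(p\<^sup>2 - 1) * n + 1 = (\<Sum>i<N. d (2 * i) * p ^ (2 * i))"
    unfolding m sum_lessThan_double using odd by simp
  also have "\<dots> = (\<Sum>i<N. if i = t then p ^ (2 * t) else 0)"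
    using t by (intro sum.cong) auto
  also have "\<dots> = (p\<^sup>2) ^ t" using t(1) by (simp add: power_mult)
  finally show ?thesis by blast
qed

text \<open>With \<open>a\<close> and \<open>b\<close> the digit sums over even and odd positions, \<open>a + b = p\<close> gives
  \<open>p \<le> a + b p \<le> p\<^sup>2\<close>. The only number in this range congruent to \<open>1\<close> modulo \<open>p\<^sup>2 - 1\<close> is
  \<open>p\<^sup>2 = (a + b) p\<close>, whence \<open>a = 0\<close>.\<close>

lemma digit_sum_prime:
  fixes p n N :: nat and d :: "nat \<Rightarrow> nat"
  assumes p: "prime p" and m: "(p\<^sup>2 - 1) * n + 1 = (\<Sum>i<2 * N. d i * p ^ i)"
    and S: "(\<Sum>i<2 * N. d i) = p"
  shows "(\<Sum>i<N. d (2 * i + 1)) = p"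
    and "(p\<^sup>2 - 1) * n + 1 = (\<Sum>i<N. d (2 * i + 1) * p ^ (2 * i + 1))"
proof -
  define a where "a = (\<Sum>i<N. d (2 * i))"
  define b where "b = (\<Sum>i<N. d (2 * i + 1))"
  have p1: "p > 1" using p by (rule prime_gt_1_nat)
  have ab: "a + b = p" using S unfolding sum_lessThan_double a_def b_def .
  have c: "[a + p * b = 1] (mod (p\<^sup>2 - 1))"
    using digits_alternating[OF p m] unfolding a_def b_def .
  have "b \<le> p * b" using p1 by simp
  then have lo: "a + p * b \<ge> p" using ab by linarith
  have hi: "a + p * b \<le> p\<^sup>2"
  proof -
    have "a \<le> p * a" using p1 by simp
    then have "a + p * b \<le> p * (a + b)" by (simp add: algebra_simps)
    then show ?thesis unfolding ab by (simp add: power2_eq_square)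
  qed
  have "p\<^sup>2 - 1 dvd a + p * b - 1"
    using c lo p1 by (simp add: cong_altdef_nat)
  then have "p\<^sup>2 - 1 \<le> a + p * b - 1" using lo p1 by (intro dvd_imp_le) auto
  with hi lo p1 have "a + p * b = p * (a + b)"
    unfolding ab by (simp add: power2_eq_square)
  then have "a = p * a" by (simp add: algebra_simps)
  then have a0: "a = 0" using p1 by simp
  with ab show "(\<Sum>i<N. d (2 * i + 1)) = p" by (simp add: b_def)
  have "d (2 * i) = 0" if "i < N" for i
    using a0 that by (simp add: a_def)
  then show "(p\<^sup>2 - 1) * n + 1 = (\<Sum>i<N. d (2 * i + 1) * p ^ (2 * i + 1))"
    unfolding m sum_lessThan_double by simp
qed

text \<open>Passes from a list of digits with their positions to a digit function on an initial segment;
  the positions not listed receive the digit \<open>0\<close>, which changes neither the sums nor the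
  product because \<open>0! = 1\<close>.\<close>

lemma sparse_to_dense_digits:
  fixes p s :: nat and j c :: "nat \<Rightarrow> nat"
  assumes j: "inj_on j {1..s}" and c: "\<forall>k\<in>{1..s}. c k < p" and p: "p > 0"
  shows "\<exists>N d. (\<forall>i. d i < p) \<and> (\<Sum>i<N. d i) = (\<Sum>k=1..s. c k)
           \<and> (\<Sum>i<N. d i * p ^ i) = (\<Sum>k=1..s. c k * p ^ j k)
           \<and> (\<Prod>i<N. fact (d i) :: int) = (\<Prod>k=1..s. fact (c k))"
proof -
  define J where "J = j ` {1..s}"
  define d where "d = (\<lambda>i. if i \<in> J then c (the_inv_into {1..s} j i) else 0)"
  obtain N where N: "J \<subseteq> {..<N}"
    using finite_nat_iff_bounded[of J] by (auto simp: J_def)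
  have dj: "d (j k) = c k" if "k \<in> {1..s}" for k
    using that j by (simp add: d_def J_def the_inv_into_f_f)
  have d0: "d i = 0" if "i \<notin> J" for i
    using that by (simp add: d_def)
  have "d i < p" for i
    using c p dj d0 by (cases "i \<in> J") (auto simp: J_def)
  moreover have "(\<Sum>i<N. d i) = (\<Sum>k=1..s. c k)"
  proof -
    have "(\<Sum>i<N. d i) = (\<Sum>i\<in>J. d i)"
      using N d0 by (intro sum.mono_neutral_right) auto
    also have "\<dots> = (\<Sum>k=1..s. c k)"
      unfolding J_def sum.reindex[OF j] comp_def using dj by (intro sum.cong) auto
    finally show ?thesis .
  qed
  moreover have "(\<Sum>i<N. d i * p ^ i) = (\<Sum>k=1..s. c k * p ^ j k)"
  proof -
    have "(\<Sum>i<N. d i * p ^ i) = (\<Sum>i\<in>J. d i * p ^ i)"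
      using N d0 by (intro sum.mono_neutral_right) auto
    also have "\<dots> = (\<Sum>k=1..s. c k * p ^ j k)"
      unfolding J_def sum.reindex[OF j] comp_def using dj by (intro sum.cong) auto
    finally show ?thesis .
  qed
  moreover have "(\<Prod>i<N. fact (d i) :: int) = (\<Prod>k=1..s. fact (c k))"
  proof -
    have "(\<Prod>i<N. fact (d i) :: int) = (\<Prod>i\<in>J. fact (d i))"
      using N d0 by (intro prod.mono_neutral_right) auto
    also have "\<dots> = (\<Prod>k=1..s. fact (c k))"
      unfolding J_def prod.reindex[OF j] comp_def using dj by (intro prod.cong) auto
    finally show ?thesis .
  qed
  ultimately show ?thesis by blast
qed

section \<open>The residue modulo the square of the prime\<close>

text \<open>Removes the division and the real subtraction from the two forms, which then become
  statements about \<open>(p\<^sup>2 - 1) n + 1\<close> in the natural numbers.\<close>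

lemma real_eq_div_iff:
  fixes p n x :: nat
  assumes p: "prime p"
  shows "real n = (real x - 1) / (real p ^ 2 - 1) \<longleftrightarrow> (p\<^sup>2 - 1) * n + 1 = x"
proof -
  have q: "p\<^sup>2 > 1" using p by (rule prime_square_gt_1)
  then have r: "real (p\<^sup>2 - 1) = real p ^ 2 - 1" by (simp add: of_nat_diff)
  have "real (p\<^sup>2 - 1) \<noteq> 0" unfolding of_nat_eq_0_iff using q by linarith
  then have nz: "real p ^ 2 - 1 \<noteq> 0" unfolding r .
  have "real n = (real x - 1) / (real p ^ 2 - 1) \<longleftrightarrow> real n * (real p ^ 2 - 1) = real x - 1"
    using nz by (simp add: eq_divide_eq)
  also have "\<dots> \<longleftrightarrow> real ((p\<^sup>2 - 1) * n + 1) = real x"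
    unfolding of_nat_add of_nat_mult r by (auto simp: mult.commute)
  finally show ?thesis unfolding of_nat_eq_iff .
qed

lemma is_form_i_iff:
  assumes "prime p"
  shows "is_form_i p n \<longleftrightarrow> (\<exists>t. (p\<^sup>2 - 1) * n + 1 = (p\<^sup>2) ^ t)"
  unfolding is_form_i_def real_eq_div_iff[OF assms, symmetric] by (simp add: power_mult)

lemma is_form_ii_iff:
  assumes "prime p"
  shows "is_form_ii p n s i c \<longleftrightarrow>
     s \<ge> 1 \<and> strict_mono_on {1..s} i \<and> (\<forall>k\<in>{1..s}. c k < p) \<and> (\<Sum>k=1..s. c k) = p \<and>
     (p\<^sup>2 - 1) * n + 1 = (\<Sum>k=1..s. c k * p ^ (2 * i k + 1))"
  unfolding is_form_ii_def real_eq_div_iff[OF assms, symmetric] by simp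

text \<open>The digit sum is \<open>p\<close>, so the valuation is \<open>1\<close>. Both the Catalan number \<open>p G\<close> and the
  multinomial coefficient \<open>p H\<close> are then multiples of \<open>p\<close>, and with \<open>P = \<Prod> c\<^sub>k!\<close> one has
  \<open>G P \<equiv> -1 \<equiv> (p - 1)! = H P\<close> modulo \<open>p\<close>; cancelling the unit \<open>P\<close> gives \<open>G \<equiv> H\<close>.\<close>

lemma s_catalan_form_ii:
  fixes p n s :: nat and i c :: "nat \<Rightarrow> nat"
  assumes p: "prime p" and form: "is_form_ii p n s i c"
  shows "[s_catalan (p\<^sup>2) n = multinomial p s c] (mod p\<^sup>2)"
proof -
  define F where "F = int (s_catalan (p\<^sup>2) n)"
  define P where "P = (\<Prod>k=1..s. fact (c k) :: int)"
  have p0: "p > 0" using p by (rule prime_gt_0_nat)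
  have i: "strict_mono_on {1..s} i" and c: "\<forall>k\<in>{1..s}. c k < p" and S: "(\<Sum>k=1..s. c k) = p"
    and m: "(p\<^sup>2 - 1) * n + 1 = (\<Sum>k=1..s. c k * p ^ (2 * i k + 1))"
    using form unfolding is_form_ii_iff[OF p] by blast+
  have "inj_on (\<lambda>k. 2 * i k + 1) {1..s}"
    by (intro inj_onI) (use inj_onD[OF strict_mono_on_imp_inj_on[OF i]] in simp)
  from sparse_to_dense_digits[OF this c p0] obtain N d where
    d: "\<And>i. d i < p" "(\<Sum>i<N. d i) = p" "(p\<^sup>2 - 1) * n + 1 = (\<Sum>i<N. d i * p ^ i)"
       "(\<Prod>i<N. fact (d i) :: int) = P"
    unfolding S m[symmetric] P_def by metis
  obtain u u0 :: int and v where u: "F * u = u0 * (- int p) ^ v" "[u = P] (mod int p)"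
      "[u0 = 1] (mod int p)" "(p - 1) * v + 1 = p"
    using s_catalan_prime_square_digits[OF p d(3)] p0 unfolding d(2,4) F_def by auto
  have "(p - 1) * v = (p - 1) * 1" using u(4) by linarith
  then have v: "v = 1" using prime_gt_1_nat[OF p] unfolding mult_cancel1 by linarith
  have cop: "coprime P (int p)"
    using coprime_prod_fact_digits[OF p, of N d] d(1) unfolding d(4) by simp
  then have "coprime u (int p)"
    using u(2) by (metis cong_imp_coprime cong_sym)
  moreover have "int p dvd F * u" unfolding u(1) v by simp
  ultimately have "int p dvd F"
    by (simp add: coprime_dvd_mult_left_iff coprime_commute)
  then obtain G where G: "F = int p * G" ..
  have "int p * (G * u) = int p * (- u0)"
    using u(1) unfolding G v by (simp add: mult_ac)
  then have Gu: "G * u = - u0" using p0 unfolding mult_cancel_left by simp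
  have "(\<Prod>k=1..s. fact (c k) :: nat) dvd fact p"
    using prod_fact_dvd_fact_sum[of c s] unfolding S .
  then have "multinomial p s c * (\<Prod>k=1..s. fact (c k)) = fact p"
    unfolding multinomial_def by (rule dvd_div_mult_self)
  from arg_cong[OF this, of int]
  have M: "int (multinomial p s c) * P = fact p"
    by (simp add: P_def)
  have fact_p: "fact p = (int p * fact (p - 1) :: int)"
    using p0 by (simp add: fact_reduce)
  have "int p dvd int (multinomial p s c) * P"
    unfolding M fact_p by simp
  then have "int p dvd int (multinomial p s c)"
    using cop by (simp add: coprime_dvd_mult_left_iff coprime_commute)
  then obtain H where H: "int (multinomial p s c) = int p * H" ..
  have "int p * (H * P) = int p * fact (p - 1)"
    using M unfolding H fact_p by (simp add: mult_ac)
  then have HP: "H * P = fact (p - 1)" using p0 by simp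
  have "[G * P = G * u] (mod int p)"
    using u(2) by (intro cong_mult cong_refl) (rule cong_sym)
  also have "[G * u = - 1] (mod int p)"
    unfolding Gu cong_minus_minus_iff by (rule u(3))
  also have "[- 1 = H * P] (mod int p)"
    unfolding HP using wilson_theorem[OF p] by (rule cong_sym)
  finally have "[G = H] (mod int p)"
    using cop by (simp add: cong_mult_rcancel)
  then have "[F = int (multinomial p s c)] (mod int p * int p)"
    unfolding G H by (simp add: cong_iff_dvd_diff flip: right_diff_distrib)
  then show ?thesis
    unfolding F_def cong_int_iff[symmetric] by (simp add: power2_eq_square)
qed

text \<open>Here \<open>m\<close> is expanded in \<open>2 m\<close> digits, which is enough as \<open>m < p^m\<close>; an even number of
  positions makes them fall into pairs. In the case \<open>v = 1\<close> all odd positions below \<open>2 m\<close> are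
  listed in the second form, zero digits included.\<close>

lemma s_catalan_forms:
  fixes p n :: nat
  assumes p: "prime p" and ndvd: "\<not> p\<^sup>2 dvd s_catalan (p\<^sup>2) n"
  shows "is_form_i p n \<or> (\<exists>s i c. is_form_ii p n s i c)"
proof -
  define m where "m = (p\<^sup>2 - 1) * n + 1"
  define d where "d = (\<lambda>i. m div p ^ i mod p)"
  have p1: "p > 1" using p by (rule prime_gt_1_nat)
  have "m < p ^ m" using p1 by (intro power_gt_expt) simp
  also have "\<dots> \<le> p ^ (2 * m)" using p1 by (intro power_increasing) auto
  finally have m: "m = (\<Sum>i<2 * m. d i * p ^ i)"
    unfolding d_def base_expansion by simp
  then have m_digits: "(p\<^sup>2 - 1) * n + 1 = (\<Sum>i<2 * m. d i * p ^ i)"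
    unfolding m_def[symmetric] .
  have d: "d i < p" for i using p1 by (simp add: d_def)
  have nz: "(\<Sum>i<2 * m. d i) \<noteq> 0"
  proof
    assume "(\<Sum>i<2 * m. d i) = 0"
    then have "(\<Sum>i<2 * m. d i * p ^ i) = 0" by simp
    with m have "m = 0" by (rule trans)
    then show False by (simp add: m_def)
  qed
  obtain u u0 :: int and v where u: "int (s_catalan (p\<^sup>2) n) * u = u0 * (- int p) ^ v"
      "[u = (\<Prod>i<2 * m. fact (d i))] (mod int p)" "(p - 1) * v + 1 = (\<Sum>i<2 * m. d i)"
    using s_catalan_prime_square_digits[OF p m_digits nz] by blast
  have "v < 2"
  proof (rule ccontr)
    assume "\<not> v < 2"
    then have "(- int p) ^ 2 dvd int (s_catalan (p\<^sup>2) n) * u"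
      unfolding u(1) by (intro dvd_mult le_imp_power_dvd) simp
    moreover have "coprime u (int p)"
      using coprime_prod_fact_digits[OF p, of "2 * m" d] d u(2) by (metis cong_imp_coprime cong_sym)
    ultimately have "int p ^ 2 dvd int (s_catalan (p\<^sup>2) n)"
      by (simp add: coprime_dvd_mult_left_iff coprime_commute)
    then have "p\<^sup>2 dvd s_catalan (p\<^sup>2) n"
      by (metis int_dvd_int_iff of_nat_power)
    with ndvd show False by contradiction
  qed
  then consider "v = 0" | "v = 1" by linarith
  then show ?thesis
  proof cases
    case 1
    then have "(\<Sum>i<2 * m. d i) = 1" using u(3) by simp
    from digit_sum_one[OF p m_digits this] show ?thesis
      unfolding is_form_i_iff[OF p] by blast
  next
    case 2
    then have S: "(\<Sum>i<2 * m. d i) = p" using u(3) p1 by simp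
    have shift: "(\<Sum>k=1..m. f (k - 1)) = (\<Sum>k<m. f k)" for f :: "nat \<Rightarrow> nat"
      by (rule sum.reindex_bij_witness[of _ Suc "\<lambda>k. k - 1"]) auto
    have "is_form_ii p n m (\<lambda>k. k - 1) (\<lambda>k. d (2 * (k - 1) + 1))"
      unfolding is_form_ii_iff[OF p]
    proof (intro conjI)
      show "m \<ge> 1" by (simp add: m_def)
      show "strict_mono_on {1..m} (\<lambda>k. k - 1)" by (auto simp: strict_mono_on_def)
      show "\<forall>k\<in>{1..m}. d (2 * (k - 1) + 1) < p" using d by blast
      show "(\<Sum>k = 1..m. d (2 * (k - 1) + 1)) = p"
        unfolding shift[of "\<lambda>k. d (2 * k + 1)"] by (rule digit_sum_prime(1)[OF p m_digits S])
      show "(p\<^sup>2 - 1) * n + 1 = (\<Sum>k = 1..m. d (2 * (k - 1) + 1) * p ^ (2 * (k - 1) + 1))"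
        unfolding shift[of "\<lambda>k. d (2 * k + 1) * p ^ (2 * k + 1)"]
        by (rule digit_sum_prime(2)[OF p m_digits S])
    qed
    then show ?thesis by blast
  qed
qed

theorem theorem6:
  fixes p n :: nat
  assumes "prime p"
  shows "(is_form_i p n \<longrightarrow> [s_catalan (p ^ 2) n = 1] (mod p ^ 2)) \<and>
         (\<forall>s i c. is_form_ii p n s i c \<longrightarrow> [s_catalan (p ^ 2) n = multinomial p s c] (mod p ^ 2)) \<and>
         (\<not> is_form_i p n \<and> \<not> (\<exists>s i c. is_form_ii p n s i c) \<longrightarrow> p ^ 2 dvd s_catalan (p ^ 2) n)"
  using s_catalan_repunit[OF assms] s_catalan_form_ii[OF assms] s_catalan_forms[OF assms]
  unfolding is_form_i_iff[OF assms] by blast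

end
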